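(* Let $\rho\ge 1$ and $b\ge 2$ be integers. Let $C_b^\rho(n)$ be the number of $\rho$-color $b$-ary partitions of $n$, and let $Y_n$ be the number of compositions of $n$ into exactly $\rho$ parts, where parts equal to $0$ are allowed (that is, the number of $\rho$-tuples of non-negative integers with sum $n$). Then for all integers $n\ge 0$, $$C_b^\rho(bn+j)=\sum_{k=0}^nY_{bk+j}\,C_b^\rho(n-k)\qquad (j=0,1,\ldots,b-1).$$
   Context: A $\rho$-color $b$-ary partition of $n$ is a finite multiset of colored parts, each being a power $b^j$ ($j\ge0$) with a color in $\{1,\dots,\rho\}$, with sum $n$ (order irrelevant, no restriction on multiplicities); $C_b^\rho(0)=1$. Equivalently, $\sum_{n\ge0}C_b^\rho(n)q^n=\prod_{j=0}^\infty\left(1-q^{b^j}\right)^{-\rho}$. The numbers $Y_n$ are the coefficients in $\sum_{n\ge0}Y_nq^n=(1-q)^{-\rho}$, so $Y_n=\binom{n+\rho-1}{\rho-1}$. *)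

theory Defs
  imports Main "HOL-Library.Multiset"
begin

text \<open>
  A coloured part is a pair of its size and its colour. Multisets make the order of the parts
  irrelevant. For \<open>b \<ge> 1\<close> all parts are positive, so there are only finitely many such multisets,
  and exactly one (the empty one) for \<open>n = 0\<close>.
\<close>

definition colored_bary_partitions :: "nat \<Rightarrow> nat \<Rightarrow> nat \<Rightarrow> (nat \<times> nat) multiset set" where
  "colored_bary_partitions b \<rho> n =
     {M. set_mset M \<subseteq> range (\<lambda>j. b ^ j) \<times> {1..\<rho>} \<and> (\<Sum>(p, c)\<in>#M. p) = n}"

definition C :: "nat \<Rightarrow> nat \<Rightarrow> nat \<Rightarrow> nat" where
  "C b \<rho> n = card (colored_bary_partitions b \<rho> n)"

definition Y :: "nat \<Rightarrow> nat \<Rightarrow> nat" where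
  "Y \<rho> n = card {xs :: nat list. length xs = \<rho> \<and> sum_list xs = n}"

end

theory Submission
  imports Defs
begin

text \<open>
  Group the parts of a coloured $b$-ary partition by whether they equal \<open>1\<close>. The parts equal to \<open>1\<close>
  are determined by the multiset of their colours; every other part is divisible by \<open>b\<close>, and dividing
  all of them by \<open>b\<close> leaves an arbitrary coloured $b$-ary partition, of size \<open>w\<close>, say. A partition
  of \<open>b n + j\<close> with \<open>0 \<le> j < b\<close> thus has exactly \<open>b (n - w) + j\<close> ones and \<open>w \<le> n\<close>, so with
  \<open>k = n - w\<close> it is the same thing as a multiset of \<open>b k + j\<close> colours together with a coloured
  $b$-ary partition of \<open>n - k\<close> (lemma \<open>bij_betw_colored_bary_partitions\<close>). Recording how often each of the
  \<open>\<rho>\<close> colours occurs turns multisets of colours into compositions with \<open>\<rho>\<close> parts (lemma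
  \<open>card_color_multisets\<close>). Combinatorially, this is the functional equation
  $F(q) = (1-q)^{-\rho} F(q^b)$ of the generating function, read off along one residue class
  of exponents modulo \<open>b\<close>.
\<close>

abbreviation part_sum :: "(nat \<times> nat) multiset \<Rightarrow> nat" where
  "part_sum M \<equiv> (\<Sum>(p, c)\<in>#M. p)"

definition color_multisets :: "nat \<Rightarrow> nat \<Rightarrow> nat multiset set" where
  "color_multisets \<rho> m = {D. set_mset D \<subseteq> {1..\<rho>} \<and> size D = m}"

definition ones_and_scaled ::
    "nat \<Rightarrow> nat multiset \<Rightarrow> (nat \<times> nat) multiset \<Rightarrow> (nat \<times> nat) multiset" where
  "ones_and_scaled b D N = image_mset (Pair 1) D + image_mset (map_prod ((*) b) id) N"

lemma finite_multisets_bounded_size: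
  assumes "finite A"
  shows "finite {M. set_mset M \<subseteq> A \<and> size M \<le> m}"
proof (rule finite_subset)
  show "{M. set_mset M \<subseteq> A \<and> size M \<le> m} \<subseteq> mset ` {xs. set xs \<subseteq> A \<and> length xs \<le> m}"
  proof
    fix M assume "M \<in> {M. set_mset M \<subseteq> A \<and> size M \<le> m}"
    moreover obtain xs where "mset xs = M"
      using ex_mset by blast
    ultimately show "M \<in> mset ` {xs. set xs \<subseteq> A \<and> length xs \<le> m}"
      by auto
  qed
  show "finite (mset ` {xs. set xs \<subseteq> A \<and> length xs \<le> m})"
    using finite_lists_length_le[OF assms] by simp
qed

lemma finite_color_multisets: "finite (color_multisets \<rho> m)"
  by (rule finite_subset[OF _ finite_multisets_bounded_size[of "{1..\<rho>}" m]])
     (auto simp: color_multisets_def)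

lemma part_le_part_sum: "x \<in># M \<Longrightarrow> fst x \<le> part_sum M"
  by (induction M) auto

lemma size_le_part_sum: "(\<And>x. x \<in># M \<Longrightarrow> 1 \<le> fst x) \<Longrightarrow> size M \<le> part_sum M"
proof (induction M)
  case (add x M)
  then have "size M \<le> part_sum M" and "1 \<le> fst x"
    by auto
  then show ?case
    by (cases x) simp
qed simp

text \<open>
  All parts are positive, so both the parts and their number are bounded by the integer being partitioned.
\<close>

lemma finite_colored_bary_partitions:
  assumes "b \<ge> 1"
  shows "finite (colored_bary_partitions b \<rho> n)"
proof (rule finite_subset)
  show "finite {M. set_mset M \<subseteq> {..n} \<times> {1..\<rho>} \<and> size M \<le> n}"
    by (rule finite_multisets_bounded_size) simp
  show "colored_bary_partitions b \<rho> n \<subseteq> {M. set_mset M \<subseteq> {..n} \<times> {1..\<rho>} \<and> size M \<le> n}"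
  proof
    fix M assume "M \<in> colored_bary_partitions b \<rho> n"
    then have parts: "set_mset M \<subseteq> range (\<lambda>i. b ^ i) \<times> {1..\<rho>}" and sum: "part_sum M = n"
      by (auto simp: colored_bary_partitions_def)
    have "1 \<le> fst x" if "x \<in># M" for x
      using parts that assms by fastforce
    then have "size M \<le> n"
      using size_le_part_sum[of M] sum by simp
    moreover have "set_mset M \<subseteq> {..n} \<times> {1..\<rho>}"
      using parts part_le_part_sum[of _ M] sum by fastforce
    ultimately show "M \<in> {M. set_mset M \<subseteq> {..n} \<times> {1..\<rho>} \<and> size M \<le> n}"
      by simp
  qed
qed

text \<open>
  The list of multiplicities of the colours \<open>1, \<dots>, \<rho>\<close> determines a multiset of colours, and every list of
  length \<open>\<rho>\<close> occurs; its sum is the number of elements of the multiset.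
\<close>

lemma card_color_multisets: "card (color_multisets \<rho> m) = Y \<rho> m"
proof -
  let ?f = "\<lambda>D. map (\<lambda>i. count D (Suc i)) [0..<\<rho>]"
  let ?g = "\<lambda>xs. \<Sum>i<\<rho>. replicate_mset (xs ! i) (Suc i)"
  have count_g: "count (?g xs) c = (if c \<in> {1..\<rho>} then xs ! (c - 1) else 0)" for xs c
  proof -
    have "count (?g xs) c = (\<Sum>i<\<rho>. if i = c - 1 then if c \<noteq> 0 then xs ! i else 0 else 0)"
      unfolding count_sum by (rule sum.cong) auto
    then show ?thesis
      by (auto simp: sum.delta)
  qed
  have fg: "?f (?g xs) = xs" if "length xs = \<rho>" for xs
    using that by (intro nth_equalityI) (auto simp: count_g)
  have gf: "?g (?f D) = D" if "set_mset D \<subseteq> {1..\<rho>}" for D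
  proof (rule multiset_eqI)
    fix c
    show "count (?g (?f D)) c = count D c"
      using that unfolding count_g by (cases "c \<in> {1..\<rho>}") (auto simp flip: not_in_iff)
  qed
  have sum_xs: "size (?g xs) = sum_list xs" if "length xs = \<rho>" for xs
  proof -
    have "size (\<Sum>i\<in>A. f i) = (\<Sum>i\<in>A. size (f i))" for A :: "nat set" and f :: "nat \<Rightarrow> nat multiset"
      by (induction A rule: infinite_finite_induct) auto
    then show ?thesis
      using that by (simp add: sum_list_sum_nth atLeast0LessThan)
  qed
  have set_g: "set_mset (?g xs) \<subseteq> {1..\<rho>}" for xs
  proof
    fix c assume "c \<in># ?g xs"
    then have "count (?g xs) c \<noteq> 0"
      by simp
    then show "c \<in> {1..\<rho>}"
      unfolding count_g by (metis (full_types))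
  qed
  have "bij_betw ?f (color_multisets \<rho> m) {xs. length xs = \<rho> \<and> sum_list xs = m}"
  proof (rule bij_betw_byWitness[where f' = ?g])
    show "\<forall>D\<in>color_multisets \<rho> m. ?g (?f D) = D"
      using gf by (simp add: color_multisets_def)
    show "\<forall>xs\<in>{xs. length xs = \<rho> \<and> sum_list xs = m}. ?f (?g xs) = xs"
      using fg by simp
    show "?f ` color_multisets \<rho> m \<subseteq> {xs. length xs = \<rho> \<and> sum_list xs = m}"
    proof
      fix xs assume "xs \<in> ?f ` color_multisets \<rho> m"
      then obtain D where D: "set_mset D \<subseteq> {1..\<rho>}" "size D = m" and xs: "xs = ?f D"
        by (auto simp: color_multisets_def)
      have len: "length xs = \<rho>"
        by (simp add: xs)
      moreover have "sum_list xs = m"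
        using sum_xs[OF len] gf[OF D(1)] D(2) unfolding xs by argo
      ultimately show "xs \<in> {xs. length xs = \<rho> \<and> sum_list xs = m}"
        by simp
    qed
    show "?g ` {xs. length xs = \<rho> \<and> sum_list xs = m} \<subseteq> color_multisets \<rho> m"
      using set_g sum_xs by (auto simp: color_multisets_def simp del: set_mset_sum)
  qed
  then show ?thesis
    by (simp add: Y_def bij_betw_same_card)
qed

lemma part_sum_ones_and_scaled: "part_sum (ones_and_scaled b D N) = size D + b * part_sum N"
proof -
  have "part_sum (image_mset (Pair 1) D) = size D"
    by (induction D) auto
  moreover have "part_sum (image_mset (map_prod ((*) b) id) N) = b * part_sum N"
    by (induction N) (auto simp: algebra_simps)
  ultimately show ?thesis
    by (simp add: ones_and_scaled_def)
qed

text \<open>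
  The colours of the parts equal to \<open>1\<close> and the quotients by \<open>b\<close> of the others can be read off
  again, because a multiple of \<open>b \<ge> 2\<close> is never \<open>1\<close>.
\<close>

lemma ones_and_scaled_inject:
  assumes "b \<ge> 2" and eq: "ones_and_scaled b D N = ones_and_scaled b D' N'"
  shows "D = D' \<and> N = N'"
proof -
  have ones: "image_mset snd (filter_mset (\<lambda>x. fst x = 1) (ones_and_scaled b D N)) = D"
    and others: "image_mset (map_prod (\<lambda>p. p div b) id)
      (filter_mset (\<lambda>x. fst x \<noteq> 1) (ones_and_scaled b D N)) = N" for D N
    using assms(1) unfolding ones_and_scaled_def
    by (simp_all add: filter_mset_image_mset multiset.map_comp comp_def
        map_prod_def case_prod_beta)
  show ?thesis
    using ones others eq by metis
qed

text \<open>
  The power \<open>b ^ 0\<close> contributes to the ones, and \<open>b ^ Suc i = b * b ^ i\<close> is again a power of \<open>b\<close>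
  scaled by \<open>b\<close>.
\<close>

lemma bary_parts_eq_ones_and_scaled:
  assumes "set_mset M \<subseteq> range (\<lambda>i. b ^ i) \<times> {1..\<rho>}"
  shows "\<exists>D N. M = ones_and_scaled b D N \<and> set_mset D \<subseteq> {1..\<rho>} \<and>
    set_mset N \<subseteq> range (\<lambda>i. b ^ i) \<times> {1..\<rho>}"
  using assms
proof (induction M)
  case empty
  show ?case
    by (intro exI[of _ "{#}"]) (simp add: ones_and_scaled_def)
next
  case (add x M)
  then obtain D N where M: "M = ones_and_scaled b D N" and D: "set_mset D \<subseteq> {1..\<rho>}"
    and N: "set_mset N \<subseteq> range (\<lambda>i. b ^ i) \<times> {1..\<rho>}"
    by auto
  obtain i c where x: "x = (b ^ i, c)" and c: "c \<in> {1..\<rho>}"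
    using add.prems by auto
  show ?case
  proof (cases i)
    case 0
    then have "add_mset x M = ones_and_scaled b (add_mset c D) N"
      by (simp add: x M ones_and_scaled_def)
    then show ?thesis
      using D N c by (intro exI[of _ "add_mset c D"] exI[of _ N]) auto
  next
    case (Suc i')
    then have "add_mset x M = ones_and_scaled b D (add_mset (b ^ i', c) N)"
      by (simp add: x M ones_and_scaled_def)
    then show ?thesis
      using D N c by (intro exI[of _ D] exI[of _ "add_mset (b ^ i', c) N"]) auto
  qed
qed

lemma set_ones_and_scaled:
  assumes "set_mset D \<subseteq> {1..\<rho>}" and "set_mset N \<subseteq> range (\<lambda>i. b ^ i) \<times> {1..\<rho>}"
  shows "set_mset (ones_and_scaled b D N) \<subseteq> range (\<lambda>i. b ^ i) \<times> {1..\<rho>}"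
proof
  fix x assume "x \<in># ones_and_scaled b D N"
  then consider c where "c \<in># D" "x = (1, c)" | p c where "(p, c) \<in># N" "x = (b * p, c)"
    by (auto simp: ones_and_scaled_def)
  then show "x \<in> range (\<lambda>i. b ^ i) \<times> {1..\<rho>}"
  proof cases
    case 1
    have "(1::nat) = b ^ 0"
      by simp
    then show ?thesis
      using 1 assms(1) by blast
  next
    case 2
    then obtain i where "p = b ^ i" and "c \<in> {1..\<rho>}"
      using assms(2) by auto
    moreover from this have "b * p = b ^ Suc i"
      by simp
    ultimately show ?thesis
      using 2 by blast
  qed
qed

text \<open>
  A partition of \<open>b n + j\<close> with \<open>d\<close> ones and quotient part of size \<open>w\<close> satisfies \<open>d + b w = b n + j\<close>.
  Since \<open>j < b\<close>, this forces \<open>w \<le> n\<close>, and then \<open>d = b k + j\<close> with \<open>k = n - w\<close>.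
\<close>

lemma bij_betw_colored_bary_partitions:
  assumes b: "b \<ge> 2" and j: "j < b"
  shows "bij_betw (\<lambda>(k, D, N). ones_and_scaled b D N)
    (SIGMA k:{0..n}. color_multisets \<rho> (b * k + j) \<times> colored_bary_partitions b \<rho> (n - k))
    (colored_bary_partitions b \<rho> (b * n + j))"
    (is "bij_betw ?f ?A ?B")
  unfolding bij_betw_def
proof
  show "inj_on ?f ?A"
  proof (rule inj_onI)
    fix x y assume xy: "x \<in> ?A" "y \<in> ?A" "?f x = ?f y"
    obtain k D N k' D' N' where eqs: "x = (k, D, N)" "y = (k', D', N')"
      by (metis prod_cases3)
    have "D = D' \<and> N = N'"
      using ones_and_scaled_inject[OF b] xy(3) by (simp add: eqs)
    \<comment> \<open>The number of ones is \<open>b k + j\<close>, so \<open>D\<close> determines \<open>k\<close>.\<close>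
    moreover from this have "b * k + j = b * k' + j"
      using xy by (simp add: eqs color_multisets_def)
    ultimately show "x = y"
      using b by (simp add: eqs)
  qed
  show "?f ` ?A = ?B"
  proof (intro equalityI subsetI)
    fix M assume "M \<in> ?f ` ?A"
    then obtain k D N where k: "k \<le> n" and D: "set_mset D \<subseteq> {1..\<rho>}" "size D = b * k + j"
      and N: "set_mset N \<subseteq> range (\<lambda>i. b ^ i) \<times> {1..\<rho>}" "part_sum N = n - k"
      and M: "M = ones_and_scaled b D N"
      by (auto simp: color_multisets_def colored_bary_partitions_def)
    have "part_sum M = b * (k + (n - k)) + j"
      unfolding M part_sum_ones_and_scaled D(2) N(2) by (simp only: algebra_simps)
    then show "M \<in> ?B"
      using k set_ones_and_scaled[OF D(1) N(1)] by (simp add: M colored_bary_partitions_def)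
  next
    fix M assume "M \<in> ?B"
    then have parts: "set_mset M \<subseteq> range (\<lambda>i. b ^ i) \<times> {1..\<rho>}" and sum: "part_sum M = b * n + j"
      by (auto simp: colored_bary_partitions_def)
    obtain D N where M: "M = ones_and_scaled b D N" and D: "set_mset D \<subseteq> {1..\<rho>}"
      and N: "set_mset N \<subseteq> range (\<lambda>i. b ^ i) \<times> {1..\<rho>}"
      using bary_parts_eq_ones_and_scaled[OF parts] by blast
    have size: "size D + b * part_sum N = b * n + j"
      using sum by (simp add: M part_sum_ones_and_scaled)
    then have "b * part_sum N < b * Suc n"
      using j by simp
    then have le: "part_sum N \<le> n"
      using b by (simp only: mult_less_cancel1 less_Suc_eq_le)
    define k where "k = n - part_sum N"
    have n: "n = k + part_sum N"
      using le by (simp add: k_def)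
    have "size D = b * k + j"
      using size by (subst (asm) n) (simp add: algebra_simps)
    then have "(k, D, N) \<in> ?A"
      using D N n by (simp add: color_multisets_def colored_bary_partitions_def)
    then show "M \<in> ?f ` ?A"
      by (rule rev_image_eqI) (simp add: M)
  qed
qed

theorem proposition6p2:
  fixes \<rho> b n j :: nat
  assumes "\<rho> \<ge> 1" and "b \<ge> 2" and "j \<in> {0..b - 1}"
  shows "C b \<rho> (b * n + j) = (\<Sum>k=0..n. Y \<rho> (b * k + j) * C b \<rho> (n - k))"
proof -
  have "j < b"
    using assms by auto
  then have "C b \<rho> (b * n + j) =
      card (SIGMA k:{0..n}. color_multisets \<rho> (b * k + j) \<times> colored_bary_partitions b \<rho> (n - k))"
    unfolding C_def
    using bij_betw_same_card[OF bij_betw_colored_bary_partitions[OF assms(2)]] by simp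
  also have "\<dots> = (\<Sum>k=0..n. card (color_multisets \<rho> (b * k + j) \<times>
      colored_bary_partitions b \<rho> (n - k)))"
    using assms(2)
    by (intro card_SigmaI) (auto simp: finite_color_multisets finite_colored_bary_partitions)
  also have "\<dots> = (\<Sum>k=0..n. Y \<rho> (b * k + j) * C b \<rho> (n - k))"
    by (simp add: card_cartesian_product card_color_multisets C_def)
  finally show ?thesis .
qed

end
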